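(* Let $X$ be a Hausdorff locally convex topological vector space, $e$ an error function on $X\times X$, $f,g:X\to\mathbb{R}\cup\{+\infty\}$ two proper and $e$-convex functions, and $x_0\in\operatorname{dom} f\cap\operatorname{dom} g$. Assume that $f-g$ attains a local minimum at $x_0$, that $e(\cdot,x_0)$ is convex, and that $e(x,x)=0$ for all $x\in\operatorname{dom} f\cap\operatorname{dom} g$. Then $\partial^e g(x_0)\subset\partial^{2e}f(x_0)$.
   Context: $\operatorname{dom} f=\{x: f(x)<+\infty\}$; $f$ is proper if $\operatorname{dom} f\ne\emptyset$. An error function is a map $e:X\times X\to\mathbb{R}\cup\{+\infty\}$ that is nonnegative, symmetric, and has nonempty domain $\operatorname{dom} e=\{(x,y): e(x,y)<+\infty\}$. $f$ is $e$-convex if $\operatorname{dom} f\times\operatorname{dom} f\subset\operatorname{dom} e$ and $f(tx+(1-t)y)\le tf(x)+(1-t)f(y)+t(1-t)e(x,y)$ for all $x,y\in X$, $t\in\,]0,1[$. $\partial^e f(x)=\{x^*\in X^*:\langle y-x,x^*\rangle\le f(y)-f(x)+e(x,y)\ \forall y\in X\}$ for $x\in\operatorname{dom} f$, empty otherwise; $\partial^{2e}f$ is the same with $e$ replaced by $2e$. Convention: $(+\infty)+(-\infty)=(-\infty)+(+\infty)=-\infty$ (so $(+\infty)-(+\infty)=-\infty$). A local minimum of $f-g$ at $x_0$ means that there is a neighborhood $U$ of $x_0$ with $f(x_0)-g(x_0)\le f(x)-g(x)$ for all $x\in U$. *)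

theory Defs
  imports "HOL-Analysis.Analysis"
begin

class topological_real_vector = real_vector + topological_ab_group_add +
  assumes tendsto_scaleR_nhds:
    "LIM p (nhds r \<times>\<^sub>F nhds a). fst p *\<^sub>R snd p :> nhds (r *\<^sub>R a)"

text \<open>The constant \<^const>\<open>convex\<close> carries a sort constraint that rules it out in a class
  specification, so its definition is written out here; see \<open>convex_nhds_base\<close> below.\<close>

class locally_convex_space = topological_real_vector +
  assumes convex_nhds_base_raw:
    "open U \<Longrightarrow> 0 \<in> U \<Longrightarrow>
      \<exists>V. (\<forall>x\<in>V. \<forall>y\<in>V. \<forall>u\<ge>0. \<forall>v\<ge>0. u + v = 1 \<longrightarrow> u *\<^sub>R x + v *\<^sub>R y \<in> V) \<and>
          V \<subseteq> U \<and> (\<forall>\<^sub>F x in nhds 0. x \<in> V)"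

lemma convex_nhds_base:
  fixes U :: "'a::locally_convex_space set"
  assumes "open U" and "0 \<in> U"
  shows "\<exists>V. convex V \<and> V \<subseteq> U \<and> (\<forall>\<^sub>F x in nhds 0. x \<in> V)"
  using convex_nhds_base_raw[OF assms] unfolding convex_def .

instance real_normed_vector \<subseteq> topological_real_vector
proof
  fix r :: real and a :: 'a
  show "LIM p (nhds r \<times>\<^sub>F nhds a). fst p *\<^sub>R snd p :> nhds (r *\<^sub>R a)"
    by (intro tendsto_scaleR filterlim_fst filterlim_snd)
qed

instance real_normed_vector \<subseteq> locally_convex_space
proof
  fix U :: "'a set"
  assume "open U" and "0 \<in> U"
  then obtain r where r: "r > 0" "ball 0 r \<subseteq> U"
    using open_contains_ball by blast
  have "\<forall>\<^sub>F x in nhds 0. x \<in> ball (0::'a) r"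
    using r by (intro eventually_nhds_in_open) auto
  with r have "\<exists>V. convex V \<and> V \<subseteq> U \<and> (\<forall>\<^sub>F x in nhds 0. x \<in> V)"
    using convex_ball by blast
  then show "\<exists>V. (\<forall>x\<in>V. \<forall>y\<in>V. \<forall>u\<ge>0. \<forall>v\<ge>0. u + v = 1 \<longrightarrow> u *\<^sub>R x + v *\<^sub>R y \<in> V) \<and>
      V \<subseteq> U \<and> (\<forall>\<^sub>F x in nhds 0. x \<in> V)"
    unfolding convex_def .
qed

definition continuous_dual :: "('a::topological_real_vector \<Rightarrow> real) set" where
  "continuous_dual = {\<phi>. linear \<phi> \<and> continuous_on UNIV \<phi>}"

text \<open>On \<^typ>\<open>ereal\<close> the library has \<open>\<infinity> + (-\<infinity>) = \<infinity>\<close> and \<open>\<infinity> - \<infinity> = \<infinity>\<close>. For differences of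
  extended-valued functions the convention here is the opposite one, in which both are \<open>-\<infinity>\<close>.\<close>

definition lower_add :: "ereal \<Rightarrow> ereal \<Rightarrow> ereal" where
  "lower_add a b = (if a = -\<infinity> \<or> b = -\<infinity> then -\<infinity> else a + b)"

definition lower_minus :: "ereal \<Rightarrow> ereal \<Rightarrow> ereal" where
  "lower_minus a b = lower_add a (- b)"

definition eff_dom :: "('a \<Rightarrow> ereal) \<Rightarrow> 'a set" where
  "eff_dom f = {x. f x < \<infinity>}"

definition proper_fun :: "('a \<Rightarrow> ereal) \<Rightarrow> bool" where
  "proper_fun f \<longleftrightarrow> eff_dom f \<noteq> {}"

definition error_dom :: "('a \<Rightarrow> 'a \<Rightarrow> ereal) \<Rightarrow> ('a \<times> 'a) set" where
  "error_dom e = {(x, y). e x y < \<infinity>}"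

definition error_function :: "('a \<Rightarrow> 'a \<Rightarrow> ereal) \<Rightarrow> bool" where
  "error_function e \<longleftrightarrow>
     (\<forall>x y. 0 \<le> e x y) \<and> (\<forall>x y. e x y = e y x) \<and> error_dom e \<noteq> {}"

text \<open>Convexity of extended-valued functions that do not take the value \<open>-\<infinity>\<close>.\<close>

definition ereal_convex :: "('a::real_vector \<Rightarrow> ereal) \<Rightarrow> bool" where
  "ereal_convex h \<longleftrightarrow>
     (\<forall>x y. \<forall>t\<in>{0<..<1::real}.
        h (t *\<^sub>R x + (1 - t) *\<^sub>R y) \<le> ereal t * h x + ereal (1 - t) * h y)"

definition e_convex :: "('a::real_vector \<Rightarrow> 'a \<Rightarrow> ereal) \<Rightarrow> ('a \<Rightarrow> ereal) \<Rightarrow> bool" where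
  "e_convex e f \<longleftrightarrow>
     eff_dom f \<times> eff_dom f \<subseteq> error_dom e \<and>
     (\<forall>x y. \<forall>t\<in>{0<..<1::real}.
        f (t *\<^sub>R x + (1 - t) *\<^sub>R y)
          \<le> ereal t * f x + ereal (1 - t) * f y + ereal (t * (1 - t)) * e x y)"

text \<open>No indeterminate sum occurs below when \<open>f\<close> avoids \<open>-\<infinity>\<close> and \<open>e\<close> is nonnegative:
  \<open>f x\<close> is then finite, so library subtraction and \<^const>\<open>lower_minus\<close> agree.\<close>

definition e_subdifferential ::
  "('a::topological_real_vector \<Rightarrow> 'a \<Rightarrow> ereal) \<Rightarrow> ('a \<Rightarrow> ereal) \<Rightarrow> 'a \<Rightarrow> ('a \<Rightarrow> real) set" where
  "e_subdifferential e f x =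
     (if x \<in> eff_dom f
      then {\<phi> \<in> continuous_dual. \<forall>y. ereal (\<phi> (y - x)) \<le> f y - f x + e x y}
      else {})"

definition local_minimum_at :: "('a::topological_space \<Rightarrow> ereal) \<Rightarrow> 'a \<Rightarrow> bool" where
  "local_minimum_at h x\<^sub>0 \<longleftrightarrow> (\<forall>\<^sub>F x in nhds x\<^sub>0. h x\<^sub>0 \<le> h x)"

end

theory Submission
  imports Defs
begin

text \<open>Let \<open>\<phi> \<in> \<partial>\<^sup>e g(x\<^sub>0)\<close> and \<open>y \<in> dom f\<close>. At a single point
  \<open>z = t y + (1 - t) x\<^sub>0\<close> so close to \<open>x\<^sub>0\<close> that local minimality applies,
  \<open>t \<phi>(y - x\<^sub>0) \<le> g(z) - g(x\<^sub>0) + e(z, x\<^sub>0) \<le> f(z) - f(x\<^sub>0) + e(z, x\<^sub>0)\<close>. The \<open>e\<close>-convexity of \<open>f\<close>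
  bounds \<open>f(z) - f(x\<^sub>0)\<close> by \<open>t (f(y) - f(x\<^sub>0)) + t (1 - t) e(y, x\<^sub>0)\<close>, and convexity of
  \<open>e(\<cdot>, x\<^sub>0)\<close> with \<open>e(x\<^sub>0, x\<^sub>0) = 0\<close> bounds \<open>e(z, x\<^sub>0)\<close> by \<open>t e(y, x\<^sub>0)\<close>. Dividing by \<open>t\<close> gives
  the error term \<open>(2 - t) e(y, x\<^sub>0) \<le> 2 e(y, x\<^sub>0)\<close>.\<close>

text \<open>The moving point is \<open>x + t *\<^sub>R (y - x)\<close>, and joint continuity of
  scaling at \<open>(0, y - x)\<close> makes the second summand vanish in the limit.\<close>

lemma tendsto_segment_at_right:
  fixes x y :: "'a::topological_real_vector"
  shows "((\<lambda>t. t *\<^sub>R y + (1 - t) *\<^sub>R x) \<longlongrightarrow> x) (at_right (0::real))"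
proof -
  have "filterlim (\<lambda>t. (t, y - x)) (nhds 0 \<times>\<^sub>F nhds (y - x)) (at_right (0::real))"
    by (intro filterlim_Pair tendsto_const) (simp add: tendsto_ident_at)
  from filterlim_compose[OF tendsto_scaleR_nhds this]
  have "((\<lambda>t. t *\<^sub>R (y - x)) \<longlongrightarrow> 0) (at_right (0::real))"
    by simp
  then have "((\<lambda>t. x + t *\<^sub>R (y - x)) \<longlongrightarrow> x + 0) (at_right (0::real))"
    by (rule tendsto_add[OF tendsto_const])
  then show ?thesis
    by (simp add: algebra_simps)
qed

text \<open>Turns a local property into one usable point of the open segment towards an arbitrary
  \<open>y\<close>, however far away \<open>y\<close> is.\<close>

lemma eventually_nhds_segment:
  fixes x y :: "'a::topological_real_vector"
  assumes "\<forall>\<^sub>F z in nhds x. P z"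
  obtains t :: real where "0 < t" "t < 1" "P (t *\<^sub>R y + (1 - t) *\<^sub>R x)"
proof -
  have "\<forall>\<^sub>F t in at_right (0::real). P (t *\<^sub>R y + (1 - t) *\<^sub>R x)"
    using assms tendsto_segment_at_right by (auto simp: filterlim_iff)
  moreover have "\<forall>\<^sub>F t in at_right (0::real). t \<in> {0<..<1}"
    by (rule eventually_at_right_real) simp
  ultimately have "\<forall>\<^sub>F t in at_right (0::real). 0 < t \<and> t < 1 \<and> P (t *\<^sub>R y + (1 - t) *\<^sub>R x)"
    by eventually_elim auto
  from eventually_happens'[OF _ this] show thesis
    using that by auto
qed

theorem theorem19:
  fixes e :: "'a::{locally_convex_space, t2_space} \<Rightarrow> 'a \<Rightarrow> ereal"
    and f g :: "'a \<Rightarrow> ereal"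
    and x\<^sub>0 :: 'a
  assumes "error_function e"
    and "\<And>x. f x \<noteq> -\<infinity>" and "\<And>x. g x \<noteq> -\<infinity>"
    and "proper_fun f" and "proper_fun g"
    and "e_convex e f" and "e_convex e g"
    and "x\<^sub>0 \<in> eff_dom f \<inter> eff_dom g"
    and "local_minimum_at (\<lambda>x. lower_minus (f x) (g x)) x\<^sub>0"
    and "ereal_convex (\<lambda>x. e x x\<^sub>0)"
    and "\<And>x. x \<in> eff_dom f \<inter> eff_dom g \<Longrightarrow> e x x = 0"
  shows "e_subdifferential e g x\<^sub>0 \<subseteq> e_subdifferential (\<lambda>x y. 2 * e x y) f x\<^sub>0"
proof
  fix \<phi> assume \<phi>: "\<phi> \<in> e_subdifferential e g x\<^sub>0"
  have dom: "f x\<^sub>0 < \<infinity>" "g x\<^sub>0 < \<infinity>"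
    using assms(8) by (auto simp: eff_dom_def)
  have dual: "\<phi> \<in> continuous_dual" and lin: "linear \<phi>"
    and sub: "\<And>y. ereal (\<phi> (y - x\<^sub>0)) \<le> g y - g x\<^sub>0 + e x\<^sub>0 y"
    using \<phi> by (auto simp: e_subdifferential_def continuous_dual_def split: if_splits)
  have e_nonneg: "0 \<le> e x y" and e_sym: "e x y = e y x" for x y
    using assms(1) unfolding error_function_def by blast+
  obtain a where a: "f x\<^sub>0 = ereal a"
    using dom(1) assms(2)[of x\<^sub>0] by (cases "f x\<^sub>0") auto
  obtain b where b: "g x\<^sub>0 = ereal b"
    using dom(2) assms(3)[of x\<^sub>0] by (cases "g x\<^sub>0") auto
  have "ereal (\<phi> (y - x\<^sub>0)) \<le> f y - f x\<^sub>0 + 2 * e x\<^sub>0 y" for y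
  proof (cases "f y")
    case PInf
    moreover have "2 * e x\<^sub>0 y \<noteq> -\<infinity>"
      using e_nonneg[of x\<^sub>0 y] by (cases "e x\<^sub>0 y") auto
    ultimately show ?thesis
      by (simp add: a)
  next
    case MInf
    then show ?thesis
      using assms(2) by simp
  next
    case (real c)
    \<comment> \<open>Both points lie in the domain of \<open>f\<close>, so the domain condition in
      \<open>e_convex\<close> makes the error finite and the rest is real arithmetic.\<close>
    then have "(y, x\<^sub>0) \<in> error_dom e"
      using assms(6) dom(1) by (auto simp: e_convex_def eff_dom_def)
    then obtain E where E: "e y x\<^sub>0 = ereal E" and "0 \<le> E"
      using e_nonneg[of y x\<^sub>0] by (cases "e y x\<^sub>0") (auto simp: error_dom_def)
    obtain t :: real where t: "0 < t" "t < 1"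
      and min_t: "lower_minus (f x\<^sub>0) (g x\<^sub>0)
        \<le> lower_minus (f (t *\<^sub>R y + (1 - t) *\<^sub>R x\<^sub>0)) (g (t *\<^sub>R y + (1 - t) *\<^sub>R x\<^sub>0))"
      using assms(9) unfolding local_minimum_at_def by (rule eventually_nhds_segment)
    define z where "z = t *\<^sub>R y + (1 - t) *\<^sub>R x\<^sub>0"
    have min: "lower_minus (f x\<^sub>0) (g x\<^sub>0) \<le> lower_minus (f z) (g z)"
      using min_t unfolding z_def .
    have "f z \<le> ereal t * f y + ereal (1 - t) * f x\<^sub>0 + ereal (t * (1 - t)) * e y x\<^sub>0"
      using assms(6) t unfolding e_convex_def z_def by (meson greaterThanLessThan_iff)
    then have fz: "f z \<le> ereal (t * c + (1 - t) * a + t * (1 - t) * E)"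
      by (simp add: real a E)
    obtain p where p: "f z = ereal p"
      using fz assms(2)[of z] by (cases "f z") auto
    \<comment> \<open>As \<open>f z\<close> is real, \<open>g z = \<infinity>\<close> would make the
      difference at \<open>z\<close> equal to -\<infinity>, below the real value
      \<open>a - b\<close> at the minimum.\<close>
    obtain q where q: "g z = ereal q"
      using min assms(3)[of z] by (cases "g z") (auto simp: lower_minus_def lower_add_def a b p)
    have min': "a - b \<le> p - q"
      using min by (simp add: lower_minus_def lower_add_def a b p q)
    have "e z x\<^sub>0 \<le> ereal t * e y x\<^sub>0 + ereal (1 - t) * e x\<^sub>0 x\<^sub>0"
      using assms(10) t unfolding ereal_convex_def z_def by (meson greaterThanLessThan_iff)
    moreover have "e x\<^sub>0 x\<^sub>0 = 0"
      using assms(8,11) by blast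
    ultimately have ez: "e z x\<^sub>0 \<le> ereal (t * E)"
      by (simp add: E)
    then obtain r where r: "e z x\<^sub>0 = ereal r" "r \<le> t * E"
      using e_nonneg[of z x\<^sub>0] by (cases "e z x\<^sub>0") auto
    have "z - x\<^sub>0 = t *\<^sub>R (y - x\<^sub>0)"
      by (simp add: z_def algebra_simps)
    then have "\<phi> (z - x\<^sub>0) = t * \<phi> (y - x\<^sub>0)"
      using linear_scale[OF lin] by simp
    then have "t * \<phi> (y - x\<^sub>0) \<le> q - b + r"
      using sub[of z] by (simp add: b q r e_sym[of x\<^sub>0])
    \<comment> \<open>Minimality gives \<open>q - b \<le> p - a\<close>. The errors
      \<open>t * (1 - t) * E\<close> from \<open>fz\<close> and \<open>t * E\<close> from
      \<open>r\<close> add up to \<open>t * (2 - t) * E\<close>.\<close>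
    also have "\<dots> \<le> t * (c - a + (2 - t) * E)"
      using min' fz r(2) by (simp add: p algebra_simps)
    finally have "\<phi> (y - x\<^sub>0) \<le> c - a + (2 - t) * E"
      using t by simp
    also have "\<dots> \<le> c - a + 2 * E"
      using t \<open>0 \<le> E\<close> by (simp add: mult_right_mono)
    finally show ?thesis
      by (simp add: real a E e_sym[of x\<^sub>0])
  qed
  then show "\<phi> \<in> e_subdifferential (\<lambda>x y. 2 * e x y) f x\<^sub>0"
    using dual dom(1) by (simp add: e_subdifferential_def eff_dom_def)
qed

end
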